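(* Consider the system $x_{k+1}=Ax_k+Bu_k+B_ww_k$ in closed loop with the MPC law $u_k=v_0^*(x_k)$, where $(v_0^*(x),\dots,v_{T-1}^*(x))$ is the minimizer of the MPC optimization problem $$\begin{aligned}\min_{v_0,\dots,v_{T-1}}\;& \sum_{l=0}^{T-1}\big(z_l^\top Qz_l+v_l^\top Rv_l\big)+z_T^\top Pz_T\\ \text{s.t. } & z_0=x,\quad z_{l+1}=Az_l+Bv_l,\\ & Hz_l\le\eta_l,\; l=1,\dots,T-1,\\ & Gv_l\le\mu_l,\; l=0,\dots,T-1,\\ & H_Tz_T\le\eta_T,\\ & (z_0,v_0)\in C_T^\infty .\end{aligned}$$ If the initial state satisfies $x_0\in C_{T,x}^\infty$, then the MPC optimization remains feasible: for every disturbance sequence with $w_k\in\mathbb{W}$ and every $k\ge 0$, the problem above with $x=x_k$ is feasible.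
   Context: System data: $x_k\in\mathbb{R}^n$, $u_k\in\mathbb{R}^m$; $w_0,w_1,\dots$ are independent realizations of a random variable $W$ with values in a bounded convex set $\mathbb{W}\subset\mathbb{R}^{m_w}$, zero mean and finite variance; $\mathbb{P}_l$ is the $l$-fold product of the law $\mathbb{P}$ of $W$, i.e. the law of $(w_0,\dots,w_{l-1})$. $H\in\mathbb{R}^{p\times n}$, $h\in\mathbb{R}^p$, $G\in\mathbb{R}^{q\times m}$, $g\in\mathbb{R}^q$, $\varepsilon\in[0,1)^p$, $\varepsilon_u,\varepsilon_T\in[0,1)$. $Q\succ0$, $R\succ0$. $K\in\mathbb{R}^{m\times n}$ is a stabilizing gain, $A_{cl}=A+BK$, and $P$ solves $A_{cl}^\top PA_{cl}+Q+K^\top RK=P$. The horizon is an integer $T\ge2$. $[M]_j$, $[a]_j$ denote the $j$-th row of a matrix and $j$-th entry of a vector; vector inequalities are componentwise. Tightened constraints: let $e_0=0$, $e_{l+1}=A_{cl}e_l+B_ww_l$. Then $[\eta_l]_j=\max\{\eta:\mathbb{P}_l\{\eta\le[h]_j-[H]_je_l\}\ge1-[\varepsilon]_j\}$ for $l=1,\dots,T-1$; $[\mu_l]_j=\max\{\mu:\mathbb{P}_l\{\mu\le[g]_j-[G]_jKe_l\}\ge1-\varepsilon_u\}$ for $l=0,\dots,T-1$ (so $\mu_0=g$). Terminal constraint: $\mathbb{X}_T=\{x:H_Tx\le h_T\}$ is a (maximal) polytope contained in $\{x: HA_{cl}x\le\eta_1,\ GKx\le g\}$ that is robust positive invariant,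 i.e. $A_{cl}x+B_ww\in\mathbb{X}_T$ for all $x\in\mathbb{X}_T$, $w\in\mathbb{W}$; and $[\eta_T]_j=\max\{\eta:\mathbb{P}_T\{\eta\le[h_T]_j-[H_T]_je_T\}\ge1-\varepsilon_T\}$. First step constraint: $C_T\subset\mathbb{R}^{n+m}$ is the set of $(z_0,v_0)$ for which there exist $v_1,\dots,v_{T-1}\in\mathbb{R}^m$ such that, with $z_{l+1}=Az_l+Bv_l$, one has $Hz_l\le\eta_l$ for $l=1,\dots,T-1$, $Gv_l\le\mu_l$ for $l=0,\dots,T-1$, and $H_Tz_T\le\eta_T$. $C_T^\infty\subseteq C_T$ is a (maximal) robust control invariant polytope inside $C_T$, and $C_{T,x}^\infty$ is the projection of $C_T^\infty$ onto the first $n$ coordinates; robust control invariance means that for every $(x,v)\in C_T^\infty$ and every $w\in\mathbb{W}$, $Ax+Bv+B_ww\in C_{T,x}^\infty$. It is assumed that $C_{T,x}^\infty$ is bounded. "(Maximal)" means the maximal set may be chosen but maximality is not required. *)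

theory Defs
  imports "HOL-Probability.Probability"
begin

definition positive_definite :: "real ^ 'n ^ 'n \<Rightarrow> bool" where
  "positive_definite M \<longleftrightarrow> transpose M = M \<and> (\<forall>x. x \<noteq> 0 \<longrightarrow> 0 < x \<bullet> (M *v x))"

text \<open>Asymptotic stability (Lyapunov stability and attractivity) of the origin for
  the discrete-time system \<open>x\<^sub>k\<^sub>+\<^sub>1 = M x\<^sub>k\<close>.\<close>

definition asymptotically_stable :: "real ^ 'n ^ 'n \<Rightarrow> bool" where
  "asymptotically_stable M \<longleftrightarrow>
     (\<forall>r>0. \<exists>d>0. \<forall>x. norm x < d \<longrightarrow> (\<forall>k. norm (((\<lambda>y. M *v y) ^^ k) x) < r)) \<and>
     (\<forall>x. (\<lambda>k. ((\<lambda>y. M *v y) ^^ k) x) \<longlonglongrightarrow> 0)"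

definition stabilizing_gain ::
    "real ^ 'n ^ 'n \<Rightarrow> real ^ 'm ^ 'n \<Rightarrow> real ^ 'n ^ 'm \<Rightarrow> bool" where
  "stabilizing_gain A B K \<longleftrightarrow> asymptotically_stable (A + B ** K)"

text \<open>The error \<open>e\<^sub>l\<close> depends only on \<open>w 0, \<dots>, w (l - 1)\<close>.\<close>

primrec error_state ::
    "real ^ 'n ^ 'n \<Rightarrow> real ^ 'd ^ 'n \<Rightarrow> (nat \<Rightarrow> real ^ 'd) \<Rightarrow> nat \<Rightarrow> real ^ 'n" where
  "error_state Acl Bw w 0 = 0"
| "error_state Acl Bw w (Suc l) = Acl *v error_state Acl Bw w l + Bw *v w l"

definition product_law :: "'d measure \<Rightarrow> nat \<Rightarrow> (nat \<Rightarrow> 'd) measure" where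
  "product_law D l = Pi\<^sub>M {..<l} (\<lambda>_. D)"

text \<open>\<open>max {t. N {t \<le> X} \<ge> 1 - \<epsilon>}\<close>; the maximum is attained if \<open>N\<close> is a probability
  measure, \<open>X\<close> is measurable and \<open>0 < \<epsilon> < 1\<close>, or \<open>\<epsilon> = 0\<close> and \<open>X\<close> is essentially
  bounded below.\<close>

definition chance_bound :: "'a measure \<Rightarrow> ('a \<Rightarrow> real) \<Rightarrow> real \<Rightarrow> real" where
  "chance_bound N X \<epsilon> = (GREATEST t. 1 - \<epsilon> \<le> measure N {\<omega> \<in> space N. t \<le> X \<omega>})"

primrec predicted_state ::
    "real ^ 'n ^ 'n \<Rightarrow> real ^ 'm ^ 'n \<Rightarrow> real ^ 'n \<Rightarrow> (nat \<Rightarrow> real ^ 'm) \<Rightarrow> nat \<Rightarrow> real ^ 'n"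
where
  "predicted_state A B z v 0 = z"
| "predicted_state A B z v (Suc l) = A *v predicted_state A B z v l + B *v v l"

text \<open>Input sequences are functions on all of \<open>nat\<close>; only the entries below the horizon
  \<open>T\<close> occur in the constraints and in the cost. The order on vectors is componentwise.\<close>

definition tightened_constraints ::
    "real ^ 'n ^ 'n \<Rightarrow> real ^ 'm ^ 'n \<Rightarrow> real ^ 'n ^ 'p \<Rightarrow> (nat \<Rightarrow> real ^ 'p) \<Rightarrow>
     real ^ 'm ^ 'q \<Rightarrow> (nat \<Rightarrow> real ^ 'q) \<Rightarrow> real ^ 'n ^ 'r \<Rightarrow> real ^ 'r \<Rightarrow> nat \<Rightarrow>
     real ^ 'n \<Rightarrow> (nat \<Rightarrow> real ^ 'm) \<Rightarrow> bool" where
  "tightened_constraints A B H \<eta> G \<mu> H\<^sub>T \<eta>\<^sub>T T z v \<longleftrightarrow>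
     (\<forall>l\<in>{1..<T}. H *v predicted_state A B z v l \<le> \<eta> l) \<and>
     (\<forall>l<T. G *v v l \<le> \<mu> l) \<and>
     H\<^sub>T *v predicted_state A B z v T \<le> \<eta>\<^sub>T"

definition first_step_set ::
    "real ^ 'n ^ 'n \<Rightarrow> real ^ 'm ^ 'n \<Rightarrow> real ^ 'n ^ 'p \<Rightarrow> (nat \<Rightarrow> real ^ 'p) \<Rightarrow>
     real ^ 'm ^ 'q \<Rightarrow> (nat \<Rightarrow> real ^ 'q) \<Rightarrow> real ^ 'n ^ 'r \<Rightarrow> real ^ 'r \<Rightarrow> nat \<Rightarrow>
     ((real ^ 'n) \<times> (real ^ 'm)) set" where
  "first_step_set A B H \<eta> G \<mu> H\<^sub>T \<eta>\<^sub>T T =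
     {(z, v\<^sub>0). \<exists>v. v 0 = v\<^sub>0 \<and> tightened_constraints A B H \<eta> G \<mu> H\<^sub>T \<eta>\<^sub>T T z v}"

definition robust_positive_invariant ::
    "real ^ 'n ^ 'n \<Rightarrow> real ^ 'd ^ 'n \<Rightarrow> (real ^ 'd) set \<Rightarrow> (real ^ 'n) set \<Rightarrow> bool" where
  "robust_positive_invariant Acl Bw \<W> X \<longleftrightarrow> (\<forall>x\<in>X. \<forall>w\<in>\<W>. Acl *v x + Bw *v w \<in> X)"

text \<open>For the constraint sets below, a polytope is a finite intersection of closed half-spaces
  (\<open>polyhedron\<close>): inputs may be unconstrained in some directions, and boundedness of the
  projection \<open>fst ` C\<close> to the state space is required separately.\<close>

definition robust_control_invariant ::
    "real ^ 'n ^ 'n \<Rightarrow> real ^ 'm ^ 'n \<Rightarrow> real ^ 'd ^ 'n \<Rightarrow> (real ^ 'd) set \<Rightarrow>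
     ((real ^ 'n) \<times> (real ^ 'm)) set \<Rightarrow> bool" where
  "robust_control_invariant A B Bw \<W> C \<longleftrightarrow>
     (\<forall>(x, v)\<in>C. \<forall>w\<in>\<W>. A *v x + B *v v + Bw *v w \<in> fst ` C)"

definition mpc_admissible ::
    "real ^ 'n ^ 'n \<Rightarrow> real ^ 'm ^ 'n \<Rightarrow> real ^ 'n ^ 'p \<Rightarrow> (nat \<Rightarrow> real ^ 'p) \<Rightarrow>
     real ^ 'm ^ 'q \<Rightarrow> (nat \<Rightarrow> real ^ 'q) \<Rightarrow> real ^ 'n ^ 'r \<Rightarrow> real ^ 'r \<Rightarrow> nat \<Rightarrow>
     ((real ^ 'n) \<times> (real ^ 'm)) set \<Rightarrow> real ^ 'n \<Rightarrow> (nat \<Rightarrow> real ^ 'm) \<Rightarrow> bool" where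
  "mpc_admissible A B H \<eta> G \<mu> H\<^sub>T \<eta>\<^sub>T T C x v \<longleftrightarrow>
     tightened_constraints A B H \<eta> G \<mu> H\<^sub>T \<eta>\<^sub>T T x v \<and> (x, v 0) \<in> C"

definition mpc_feasible ::
    "real ^ 'n ^ 'n \<Rightarrow> real ^ 'm ^ 'n \<Rightarrow> real ^ 'n ^ 'p \<Rightarrow> (nat \<Rightarrow> real ^ 'p) \<Rightarrow>
     real ^ 'm ^ 'q \<Rightarrow> (nat \<Rightarrow> real ^ 'q) \<Rightarrow> real ^ 'n ^ 'r \<Rightarrow> real ^ 'r \<Rightarrow> nat \<Rightarrow>
     ((real ^ 'n) \<times> (real ^ 'm)) set \<Rightarrow> real ^ 'n \<Rightarrow> bool" where
  "mpc_feasible A B H \<eta> G \<mu> H\<^sub>T \<eta>\<^sub>T T C x \<longleftrightarrow>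
     (\<exists>v. mpc_admissible A B H \<eta> G \<mu> H\<^sub>T \<eta>\<^sub>T T C x v)"

definition mpc_cost ::
    "real ^ 'n ^ 'n \<Rightarrow> real ^ 'm ^ 'n \<Rightarrow> real ^ 'n ^ 'n \<Rightarrow> real ^ 'm ^ 'm \<Rightarrow> real ^ 'n ^ 'n \<Rightarrow>
     nat \<Rightarrow> real ^ 'n \<Rightarrow> (nat \<Rightarrow> real ^ 'm) \<Rightarrow> real" where
  "mpc_cost A B Q R P T x v =
     (let z = predicted_state A B x v
      in (\<Sum>l<T. z l \<bullet> (Q *v z l) + v l \<bullet> (R *v v l)) + z T \<bullet> (P *v z T))"

text \<open>\<open>arg_min\<close> chooses among minimizers that may differ from entry \<open>T\<close> on, which does not
  affect the first input; it is unspecified where no minimizer exists.\<close>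

definition mpc_law ::
    "real ^ 'n ^ 'n \<Rightarrow> real ^ 'm ^ 'n \<Rightarrow> real ^ 'n ^ 'n \<Rightarrow> real ^ 'm ^ 'm \<Rightarrow> real ^ 'n ^ 'n \<Rightarrow>
     real ^ 'n ^ 'p \<Rightarrow> (nat \<Rightarrow> real ^ 'p) \<Rightarrow>
     real ^ 'm ^ 'q \<Rightarrow> (nat \<Rightarrow> real ^ 'q) \<Rightarrow> real ^ 'n ^ 'r \<Rightarrow> real ^ 'r \<Rightarrow> nat \<Rightarrow>
     ((real ^ 'n) \<times> (real ^ 'm)) set \<Rightarrow> real ^ 'n \<Rightarrow> real ^ 'm" where
  "mpc_law A B Q R P H \<eta> G \<mu> H\<^sub>T \<eta>\<^sub>T T C x =
     (arg_min (mpc_cost A B Q R P T x) (mpc_admissible A B H \<eta> G \<mu> H\<^sub>T \<eta>\<^sub>T T C x)) 0"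

end

theory Submission
  imports Defs
begin

text \<open>
  Recursive feasibility is inherited from the first step constraint: every state in
  the projection \<open>fst ` C\<close> admits a feasible input sequence, because \<open>C\<close> lies in the first step
  set, and the constraint \<open>(x, v 0) \<in> C\<close> on the applied input, together with robust control
  invariance, puts the successor state back into the projection for every disturbance in \<open>\<W>\<close>
  (lemma \<open>feasible_iff_in_projection\<close> and the induction in the theorem).

  It remains to see \<open>(x, u) \<in> C\<close> for the applied input \<open>u\<close>, that is, that the law,
  defined through a minimizer, really returns an admissible input: a minimizer must exist whenever
  the problem is feasible (lemma \<open>mpc_minimizer_exists\<close>). The admissible sequences form
  a closed set and the cost is continuous. The cost is coercive in the inputs
  (\<open>mpc_cost_coercive\<close>): \<open>R\<close> is positive definite, and the terminal weight \<open>P\<close>, given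
  as a solution of the Lyapunov equation, has a nonnegative quadratic
  form since \<open>Acl\<close> is stable (\<open>lyapunov_solution_nonneg\<close>). Restricting to a sublevel set of the cost
  and setting the irrelevant entries from \<open>T\<close> on to zero leaves a
  minimization over a compact set.
\<close>

section \<open>Quadratic forms\<close>

text \<open>By compactness of the unit sphere and homogeneity.\<close>

lemma positive_definite_lower_bound:
  fixes R :: "real ^ 'm ^ 'm"
  assumes "positive_definite R"
  obtains c where "c > 0" "\<And>y. c * (norm y)\<^sup>2 \<le> y \<bullet> (R *v y)"
proof -
  let ?q = "\<lambda>y. y \<bullet> (R *v y)"
  have "sphere (0 :: real ^ 'm) 1 \<noteq> {}" by simp
  moreover have "continuous_on (sphere 0 1) ?q" by (intro continuous_intros)
  ultimately obtain s where s: "s \<in> sphere 0 1" "\<And>y. y \<in> sphere 0 1 \<Longrightarrow> ?q s \<le> ?q y"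
    using continuous_attains_inf[of "sphere 0 1" ?q] compact_sphere by blast
  show thesis
  proof
    have "s \<noteq> 0" using s(1) by auto
    then show "?q s > 0" using assms by (simp add: positive_definite_def)
    fix y :: "real ^ 'm"
    show "?q s * (norm y)\<^sup>2 \<le> ?q y"
    proof (cases "y = 0")
      case False
      then have "?q s \<le> ?q (y /\<^sub>R norm y)" by (intro s(2)) simp
      also have "\<dots> = ?q y / (norm y)\<^sup>2"
        by (simp add: scaleR_matrix_vector_assoc[symmetric] matrix_vector_mult_scaleR
            power2_eq_square divide_simps)
      finally show ?thesis using False by (simp add: pos_le_divide_eq)
    qed simp
  qed
qed

lemma positive_definite_nonneg: "positive_definite M \<Longrightarrow> 0 \<le> y \<bullet> (M *v y)"
  by (cases "y = 0") (auto simp: positive_definite_def dest: less_imp_le)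

lemma quadratic_form_congruence:
  fixes P :: "real ^ 'n ^ 'n" and N :: "real ^ 'm ^ 'n"
  shows "y \<bullet> ((transpose N ** P ** N) *v y) = (N *v y) \<bullet> (P *v (N *v y))"
proof -
  have "(N *v y) \<bullet> (P *v (N *v y)) = (P *v (N *v y)) \<bullet> (N *v y)" by (rule inner_commute)
  also have "\<dots> = ((P *v (N *v y)) v* N) \<bullet> y" by (rule dot_lmul_matrix[symmetric])
  finally show ?thesis
    by (simp add: matrix_vector_mul_assoc[symmetric] inner_commute)
qed

text \<open>The quadratic form of a solution does not increase along the trajectories of \<open>N\<close>, and
  along them it tends to its value at the origin; hence its value is nonnegative everywhere.\<close>

lemma lyapunov_solution_nonneg:
  fixes P S N :: "real ^ 'n ^ 'n"
  assumes stable: "asymptotically_stable N"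
    and eq: "transpose N ** P ** N + S = P"
    and S: "\<And>y. 0 \<le> y \<bullet> (S *v y)"
  shows "0 \<le> y \<bullet> (P *v y)"
proof -
  let ?q = "\<lambda>y. y \<bullet> (P *v y)"
  let ?y = "\<lambda>k. ((\<lambda>z. N *v z) ^^ k) y"
  have "?q (N *v z) \<le> ?q z" for z
  proof -
    have "?q z = z \<bullet> ((transpose N ** P ** N + S) *v z)" by (simp only: eq)
    also have "\<dots> = ?q (N *v z) + z \<bullet> (S *v z)"
      by (simp only: matrix_vector_mult_add_rdistrib inner_add_right quadratic_form_congruence)
    finally show ?thesis using S[of z] by simp
  qed
  then have "?q (?y k) \<le> ?q y" for k by (induction k) (auto intro: order_trans)
  moreover have "?y \<longlonglongrightarrow> 0" using stable by (simp add: asymptotically_stable_def)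
  then have "(\<lambda>k. ?q (?y k)) \<longlonglongrightarrow> ?q 0"
    by (intro tendsto_inner bounded_linear.tendsto[OF matrix_vector_mul_bounded_linear])
  ultimately have "?q 0 \<le> ?q y" by (intro LIMSEQ_le_const2) auto
  then show ?thesis by simp
qed

section \<open>Dependence on the input sequence\<close>

lemma predicted_state_cong:
  "(\<And>i. i < l \<Longrightarrow> v i = v' i) \<Longrightarrow> predicted_state A B x v l = predicted_state A B x v' l"
  by (induction l) auto

lemma mpc_cost_cong:
  assumes "\<And>i. i < T \<Longrightarrow> v i = v' i"
  shows "mpc_cost A B Q R P T x v = mpc_cost A B Q R P T x v'"
proof -
  have "predicted_state A B x v l = predicted_state A B x v' l" if "l \<le> T" for l
    using assms that by (intro predicted_state_cong) auto
  then show ?thesis using assms by (auto simp: mpc_cost_def Let_def intro!: sum.cong)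
qed

lemma mpc_admissible_cong:
  assumes "T > 0" and eq: "\<And>i. i < T \<Longrightarrow> v i = v' i"
  shows "mpc_admissible A B H \<eta> G \<mu> H\<^sub>T \<eta>\<^sub>T T C x v
    \<longleftrightarrow> mpc_admissible A B H \<eta> G \<mu> H\<^sub>T \<eta>\<^sub>T T C x v'"
proof -
  have "predicted_state A B x v l = predicted_state A B x v' l" if "l \<le> T" for l
    using eq that by (intro predicted_state_cong) auto
  then show ?thesis using assms by (auto simp: mpc_admissible_def tightened_constraints_def)
qed

lemma continuous_on_input [continuous_intros]: "continuous_on S (\<lambda>v. v i)"
  by (rule continuous_on_product_then_coordinatewise[OF continuous_on_id])

lemma continuous_on_predicted_state [continuous_intros]:
  "continuous_on S (\<lambda>v. predicted_state A B x v l)"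
proof (induction l)
  case (Suc l)
  then show ?case
    by (auto intro!: continuous_intros
        bounded_linear.continuous_on[OF matrix_vector_mul_bounded_linear])
qed auto

lemma continuous_on_mpc_cost: "continuous_on S (mpc_cost A B Q R P T x)"
  unfolding mpc_cost_def Let_def
  by (intro continuous_intros bounded_linear.continuous_on[OF matrix_vector_mul_bounded_linear])

lemma closed_mpc_admissible:
  assumes "closed C"
  shows "closed {v. mpc_admissible A B H \<eta> G \<mu> H\<^sub>T \<eta>\<^sub>T T C x v}"
proof -
  have halfspaces: "closed {v. N *v f v \<le> b}" if "continuous_on UNIV f"
    for N :: "real ^ 'k ^ 'i" and b and f :: "(nat \<Rightarrow> real ^ 'l) \<Rightarrow> real ^ 'k"
  proof -
    have "continuous_on UNIV (\<lambda>v. N *v f v)"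
      using that by (rule bounded_linear.continuous_on[OF matrix_vector_mul_bounded_linear])
    then show ?thesis unfolding less_eq_vec_def
      by (intro closed_Collect_all closed_Collect_le continuous_on_component
          continuous_on_const)
  qed
  have "closed ((\<lambda>v. (x, v 0)) -` C)"
    using assms by (intro closed_vimage continuous_intros)
  then show ?thesis
    unfolding mpc_admissible_def tightened_constraints_def Ball_def vimage_def
    by (intro closed_Collect_conj closed_Collect_all closed_Collect_imp open_Collect_const
        halfspaces continuous_intros)
qed

section \<open>Existence of a minimizer\<close>

lemma mpc_cost_coercive:
  assumes Q: "\<And>y. 0 \<le> y \<bullet> (Q *v y)" and P: "\<And>y. 0 \<le> y \<bullet> (P *v y)"
    and "0 \<le> c" and R: "\<And>y. c * (norm y)\<^sup>2 \<le> y \<bullet> (R *v y)"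
    and "l < T"
  shows "c * (norm (v l))\<^sup>2 \<le> mpc_cost A B Q R P T x v"
proof -
  let ?z = "predicted_state A B x v"
  let ?stage = "\<lambda>l. ?z l \<bullet> (Q *v ?z l) + v l \<bullet> (R *v v l)"
  have "0 \<le> v i \<bullet> (R *v v i)" for i
    using \<open>0 \<le> c\<close> by (intro order_trans[OF _ R]) simp
  then have "?stage l \<le> (\<Sum>l<T. ?stage l)"
    using Q \<open>l < T\<close> by (intro member_le_sum) (auto intro: add_nonneg_nonneg)
  then show ?thesis
    using R[of "v l"] Q[of "?z l"] P[of "?z T"] by (simp add: mpc_cost_def Let_def)
qed

lemma compact_input_box:
  "compact {v :: nat \<Rightarrow> real ^ 'm. \<forall>i. v i \<in> (if i < T then cball 0 r else {0})}"
proof -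
  let ?S = "\<lambda>i. if i < T then cball (0 :: real ^ 'm) r else {0}"
  have "compactin (product_topology (\<lambda>_. euclidean) UNIV) (PiE UNIV ?S)"
    by (auto simp: compactin_PiE)
  moreover have "PiE UNIV ?S = {v. \<forall>i. v i \<in> ?S i}" unfolding PiE_UNIV_domain by (auto simp: Pi_def)
  ultimately show ?thesis by (simp only: euclidean_product_topology compactin_euclidean_iff)
qed

text \<open>Since neither the constraints nor the cost see the entries from \<open>T\<close> on, these may be set to
  zero; sequences that are no more expensive than a given admissible one then form a subset of
  a product of compact sets.\<close>

lemma mpc_minimizer_exists:
  fixes B :: "real ^ 'm ^ 'n"
  assumes "T > 0" and "closed C"
    and Q: "\<And>y. 0 \<le> y \<bullet> (Q *v y)" and R: "positive_definite R"
    and P: "\<And>y. 0 \<le> y \<bullet> (P *v y)"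
    and feasible: "mpc_feasible A B H \<eta> G \<mu> H\<^sub>T \<eta>\<^sub>T T C x"
  shows "\<exists>v. is_arg_min (mpc_cost A B Q R P T x) (mpc_admissible A B H \<eta> G \<mu> H\<^sub>T \<eta>\<^sub>T T C x) v"
proof -
  let ?J = "mpc_cost A B Q R P T x"
  let ?adm = "mpc_admissible A B H \<eta> G \<mu> H\<^sub>T \<eta>\<^sub>T T C x"
  obtain c where c: "c > 0" "\<And>y. c * (norm y)\<^sup>2 \<le> y \<bullet> (R *v y)"
    using positive_definite_lower_bound[OF R] by blast
  obtain v' where v': "?adm v'" using feasible by (auto simp: mpc_feasible_def)
  \<comment> \<open>Coercivity bounds by \<open>r\<close> the first \<open>T\<close> inputs of a sequence no more expensive than \<open>v'\<close>.\<close>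
  define r where "r = sqrt (?J v' / c)"
  define box where
    "box = {v :: nat \<Rightarrow> real ^ 'm. \<forall>i. v i \<in> (if i < T then cball 0 r else {0})}"
  define trunc where "trunc v i = (if i < T then v i else 0)" for v :: "nat \<Rightarrow> real ^ 'm" and i
  have trunc: "?adm (trunc v) \<longleftrightarrow> ?adm v" "?J (trunc v) = ?J v" for v
    using \<open>T > 0\<close> by (auto simp: trunc_def intro!: mpc_admissible_cong mpc_cost_cong)
  have in_box: "trunc v \<in> box" if "?J v \<le> ?J v'" for v
  proof -
    have "norm (v i) \<le> r" if "i < T" for i
    proof -
      have "c * (norm (v i))\<^sup>2 \<le> ?J v'"
        using mpc_cost_coercive[where c = c and v = v and l = i and T = T and x = x, OF Q P _ c(2) that]
          c(1) \<open>?J v \<le> ?J v'\<close> by (meson less_imp_le order_trans)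
      then show ?thesis
        using c(1) unfolding r_def by (intro real_le_rsqrt) (simp add: field_simps)
    qed
    then show ?thesis by (auto simp: box_def trunc_def)
  qed
  have "compact (box \<inter> {v. ?adm v})"
    unfolding box_def by (intro compact_Int_closed compact_input_box closed_mpc_admissible assms)
  moreover have "trunc v' \<in> box \<inter> {v. ?adm v}" using in_box[of v'] trunc v' by simp
  ultimately obtain v where v: "?adm v" "\<And>u. u \<in> box \<inter> {v. ?adm v} \<Longrightarrow> ?J v \<le> ?J u"
    using continuous_attains_inf[of "box \<inter> {v. ?adm v}" ?J] continuous_on_mpc_cost by blast
  have "?J v \<le> ?J u" if "?adm u" for u
  proof (cases "?J u \<le> ?J v'")
    case True
    then show ?thesis using v(2)[of "trunc u"] in_box trunc that by simp
  next
    case False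
    then show ?thesis using v(2)[of "trunc v'"] in_box[of v'] trunc v' by simp
  qed
  then show ?thesis using v(1) by (auto simp: is_arg_min_linorder)
qed

section \<open>Recursive feasibility\<close>

lemma feasible_iff_in_projection:
  assumes "C \<subseteq> first_step_set A B H \<eta> G \<mu> H\<^sub>T \<eta>\<^sub>T T"
  shows "mpc_feasible A B H \<eta> G \<mu> H\<^sub>T \<eta>\<^sub>T T C x \<longleftrightarrow> x \<in> fst ` C"
proof
  assume "x \<in> fst ` C"
  then obtain v\<^sub>0 where "(x, v\<^sub>0) \<in> C" by force
  then show "mpc_feasible A B H \<eta> G \<mu> H\<^sub>T \<eta>\<^sub>T T C x"
    using assms by (fastforce simp: first_step_set_def mpc_feasible_def mpc_admissible_def)
qed (force simp: mpc_feasible_def mpc_admissible_def)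

theorem proposition4:
  fixes M :: "'a measure" and W :: "'a \<Rightarrow> real ^ 'd" and \<W> :: "(real ^ 'd) set"
    and A :: "real ^ 'n ^ 'n" and B :: "real ^ 'm ^ 'n" and Bw :: "real ^ 'd ^ 'n"
    and H :: "real ^ 'n ^ 'p" and h :: "real ^ 'p"
    and G :: "real ^ 'm ^ 'q" and g :: "real ^ 'q"
    and \<epsilon> :: "real ^ 'p" and \<epsilon>\<^sub>u \<epsilon>\<^sub>T :: real
    and Q P Acl :: "real ^ 'n ^ 'n" and R :: "real ^ 'm ^ 'm" and K :: "real ^ 'n ^ 'm"
    and T :: nat
    and \<eta> :: "nat \<Rightarrow> real ^ 'p" and \<mu> :: "nat \<Rightarrow> real ^ 'q"
    and H\<^sub>T :: "real ^ 'n ^ 'r" and h\<^sub>T \<eta>\<^sub>T :: "real ^ 'r"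
    and X\<^sub>T :: "(real ^ 'n) set" and C :: "((real ^ 'n) \<times> (real ^ 'm)) set"
    and x :: "nat \<Rightarrow> real ^ 'n" and u :: "nat \<Rightarrow> real ^ 'm" and w :: "nat \<Rightarrow> real ^ 'd"
  assumes W_set: "bounded \<W>" "convex \<W>"
    and W_rv: "prob_space M" "W \<in> borel_measurable M" "\<And>\<omega>. \<omega> \<in> space M \<Longrightarrow> W \<omega> \<in> \<W>"
    and W_mean: "integrable M W" "(LINT \<omega>|M. W \<omega>) = 0"
    and W_var: "integrable M (\<lambda>\<omega>. (norm (W \<omega>))\<^sup>2)"
    and eps: "\<And>j. 0 \<le> \<epsilon> $ j \<and> \<epsilon> $ j < 1"
    and eps_u: "0 \<le> \<epsilon>\<^sub>u" "\<epsilon>\<^sub>u < 1"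
    and eps_T: "0 \<le> \<epsilon>\<^sub>T" "\<epsilon>\<^sub>T < 1"
    and weights: "positive_definite Q" "positive_definite R"
    and gain: "stabilizing_gain A B K" "Acl = A + B ** K"
    and lyapunov: "transpose Acl ** P ** Acl + Q + transpose K ** R ** K = P"
    and horizon: "T \<ge> 2"
    and eta: "\<And>l j. l \<in> {1..<T} \<Longrightarrow>
      \<eta> l $ j = chance_bound (product_law (distr M borel W) l)
        (\<lambda>\<omega>. (h - H *v error_state Acl Bw \<omega> l) $ j) (\<epsilon> $ j)"
    and mu: "\<And>l j. l < T \<Longrightarrow>
      \<mu> l $ j = chance_bound (product_law (distr M borel W) l)
        (\<lambda>\<omega>. (g - (G ** K) *v error_state Acl Bw \<omega> l) $ j) \<epsilon>\<^sub>u"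
    and terminal_set: "X\<^sub>T = {y. H\<^sub>T *v y \<le> h\<^sub>T}" "polyhedron X\<^sub>T"
      "X\<^sub>T \<subseteq> {y. (H ** Acl) *v y \<le> \<eta> 1 \<and> (G ** K) *v y \<le> g}"
      "robust_positive_invariant Acl Bw \<W> X\<^sub>T"
    and eta_T: "\<And>j. \<eta>\<^sub>T $ j = chance_bound (product_law (distr M borel W) T)
        (\<lambda>\<omega>. (h\<^sub>T - H\<^sub>T *v error_state Acl Bw \<omega> T) $ j) \<epsilon>\<^sub>T"
    and first_step: "polyhedron C" "C \<subseteq> first_step_set A B H \<eta> G \<mu> H\<^sub>T \<eta>\<^sub>T T"
      "robust_control_invariant A B Bw \<W> C" "bounded (fst ` C)"
    and initial: "x 0 \<in> fst ` C"
    and disturbance: "\<And>k. w k \<in> \<W>"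
    and input: "\<And>k. u k = mpc_law A B Q R P H \<eta> G \<mu> H\<^sub>T \<eta>\<^sub>T T C (x k)"
    and closed_loop: "\<And>k. x (Suc k) = A *v x k + B *v u k + Bw *v w k"
  shows "\<forall>k. mpc_feasible A B H \<eta> G \<mu> H\<^sub>T \<eta>\<^sub>T T C (x k)"
proof -
  let ?feasible = "mpc_feasible A B H \<eta> G \<mu> H\<^sub>T \<eta>\<^sub>T T C"
  have P: "0 \<le> y \<bullet> (P *v y)" for y
  proof (rule lyapunov_solution_nonneg)
    show "asymptotically_stable Acl" using gain by (simp add: stabilizing_gain_def)
    show "transpose Acl ** P ** Acl + (Q + transpose K ** R ** K) = P"
      using lyapunov by (simp add: add.assoc)
    show "0 \<le> z \<bullet> ((Q + transpose K ** R ** K) *v z)" for z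
      by (simp only: matrix_vector_mult_add_rdistrib inner_add_right quadratic_form_congruence)
        (intro add_nonneg_nonneg positive_definite_nonneg weights)
  qed
  have input_in_C: "(x k, u k) \<in> C" if "?feasible (x k)" for k
  proof -
    have "\<exists>v. is_arg_min (mpc_cost A B Q R P T (x k))
        (mpc_admissible A B H \<eta> G \<mu> H\<^sub>T \<eta>\<^sub>T T C (x k)) v"
      using horizon first_step(1) weights P that
      by (intro mpc_minimizer_exists) (auto intro: polyhedron_imp_closed positive_definite_nonneg)
    then have "mpc_admissible A B H \<eta> G \<mu> H\<^sub>T \<eta>\<^sub>T T C (x k)
        (arg_min (mpc_cost A B Q R P T (x k)) (mpc_admissible A B H \<eta> G \<mu> H\<^sub>T \<eta>\<^sub>T T C (x k)))"
      unfolding arg_min_def by (rule someI2_ex) (simp add: is_arg_min_def)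
    then show ?thesis by (simp add: mpc_admissible_def input mpc_law_def)
  qed
  have "?feasible (x k)" for k
  proof (induction k)
    case 0
    show ?case using initial feasible_iff_in_projection[OF first_step(2)] by simp
  next
    case (Suc k)
    then have "A *v x k + B *v u k + Bw *v w k \<in> fst ` C"
      using first_step(3) input_in_C[of k] disturbance[of k]
      unfolding robust_control_invariant_def by fast
    then show ?case
      using feasible_iff_in_projection[OF first_step(2)] by (simp add: closed_loop)
  qed
  then show ?thesis by blast
qed

end
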